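(* Let $\mathcal X$ be a finite alphabet, let $\mathcal M$ be a countable set of probability distributions on sequences over $\mathcal X$, let $\xi(x_{1:n})=\sum_{\nu\in\mathcal M}w_\nu\,\nu(x_{1:n})$ with weights $w_\nu>0$, $\sum_{\nu\in\mathcal M}w_\nu=1$, and let sequences $x_1x_2\ldots$ be drawn from a distribution $\mu\in\mathcal M$, i.e. the first $n$ symbols are drawn with probability $\mu(x_{1:n})$. For a distribution $\rho$, the predictor $\Theta_\rho$ predicts $x_t^{\Theta_\rho}\in\mathcal X$ from $x_{<t}$, where $x_t^{\Theta_\rho}$ maximizes $\rho(x_t|x_{<t})$ over $x_t\in\mathcal X$. Let $E_n^{\Theta_\rho}$ be the total $\mu$-expected number of prediction errors of $\Theta_\rho$ in the first $n$ predictions. Let $Q_n=\sum_{t=1}^n\mathbf E_{<t}\,q_t$ with $q_t(x_{<t})=1$ if $x_t^{\Theta_\xi}\neq x_t^{\Theta_\mu}$ and $q_t(x_{<t})=0$ otherwise, be the expected number of non-optimal predictions of $\Theta_\xi$. Then for every $n$ $$0\le E_n^{\Theta_\xi}-E_n^{\Theta_\mu}\le\sqrt{2Q_nS_n}\le\sqrt{2\big(E_n^{\Theta_\xi}+E_n^{\Theta_\mu}\big)S_n}\le S_n+\sqrt{4E_n^{\Theta_\mu}S_n+S_n^2}\le 2S_n+2\sqrt{E_n^{\Theta_\mu}S_n},$$ where $S_n\le V_n\le D_n\le\ln w_\mu^{-1}$, with $S_n$ the expected cumulative squared Euclidean distance, $V_n$ half of the expected cumulative squared absolute distance, and $D_n$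 the relative entropy between $\mu$ and $\xi$.
   Context: Notation: $x_{1:n}=x_1\ldots x_n$, $x_{<t}=x_1\ldots x_{t-1}$. A probability distribution $\rho$ on sequences is given by $\rho(x_{1:n})$, the probability that an infinite sequence starts with $x_{1:n}$; thus $\rho(\text{empty string})=1$ and $\sum_{x_t\in\mathcal X}\rho(x_{1:t})=\rho(x_{<t})$. Conditional probabilities are $\rho(x_t|x_{<t})=\rho(x_{1:t})/\rho(x_{<t})$, defined to be $0$ if $\rho(x_{<t})=0$. Expectations are with respect to the true distribution $\mu$: $\mathbf E_{<t}[\cdot]=\sum_{x_{<t}\in\mathcal X^{t-1}}\mu(x_{<t})[\cdot]$, $\mathbf E_{1:n}[\cdot]=\sum_{x_{1:n}\in\mathcal X^n}\mu(x_{1:n})[\cdot]$. Ties in the maximization defining $x_t^{\Theta_\rho}$ are broken arbitrarily. Errors: $e_t^{\Theta_\rho}(x_{<t})=1-\mu(x_t^{\Theta_\rho}|x_{<t})$ and $E_n^{\Theta_\rho}=\sum_{t=1}^n\mathbf E_{<t}\,e_t^{\Theta_\rho}(x_{<t})$. Distances: $S_n=\sum_{t=1}^n\mathbf E_{<t}\sum_{x_t}\big(\mu(x_t|x_{<t})-\xi(x_t|x_{<t})\big)^2$; $V_n=\frac12\sum_{t=1}^n\mathbf E_{<t}\Big(\sum_{x_t}\big|\mu(x_t|x_{<t})-\xi(x_t|x_{<t})\big|\Big)^2$; $D_n=\mathbf E_{1:n}\ln\frac{\mu(x_{1:n})}{\xi(x_{1:n})}$. *)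

theory Defs
  imports "HOL-Probability.Probability"
begin

definition sequence_distribution :: "'a::finite stream measure \<Rightarrow> bool" where
  "sequence_distribution \<rho> \<longleftrightarrow>
     prob_space \<rho> \<and> sets \<rho> = sets (stream_space (count_space UNIV))"

definition prefix_prob :: "'a stream measure \<Rightarrow> 'a list \<Rightarrow> real" where
  "prefix_prob \<rho> x = measure \<rho> {\<omega> \<in> space \<rho>. stake (length x) \<omega> = x}"

definition mixture ::
  "'a stream measure set \<Rightarrow> ('a stream measure \<Rightarrow> real) \<Rightarrow> 'a list \<Rightarrow> real" where
  "mixture M w x = (\<Sum>\<^sub>\<infinity>\<nu>\<in>M. w \<nu> * prefix_prob \<nu> x)"

text \<open>
  From here on a distribution is represented by its prefix probabilities, a function on
  finite words. A word \<open>h\<close> of length \<open>t - 1\<close> is the history \<open>x\<^sub>1\<dots>x\<^sub>t\<^sub>-\<^sub>1\<close>.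
  Since \<open>a / 0 = 0\<close>, \<open>next_prob \<rho> h a\<close> is \<open>0\<close> whenever \<open>\<rho> h = 0\<close>.
\<close>

definition next_prob :: "('a list \<Rightarrow> real) \<Rightarrow> 'a list \<Rightarrow> 'a \<Rightarrow> real" where
  "next_prob \<rho> h a = \<rho> (h @ [a]) / \<rho> h"

definition word_expectation ::
  "('a::finite list \<Rightarrow> real) \<Rightarrow> nat \<Rightarrow> ('a list \<Rightarrow> real) \<Rightarrow> real" where
  "word_expectation \<mu> k f = (\<Sum>x | length x = k. \<mu> x * f x)"

text \<open>
  Ties are broken arbitrarily: the predictor of \<open>\<rho>\<close> is any function \<open>\<theta>\<close> on histories that
  picks some maximiser.
\<close>

definition is_predictor :: "('a list \<Rightarrow> real) \<Rightarrow> ('a list \<Rightarrow> 'a) \<Rightarrow> bool" where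
  "is_predictor \<rho> \<theta> \<longleftrightarrow> (\<forall>h. is_arg_max (next_prob \<rho> h) (\<lambda>_. True) (\<theta> h))"

definition expected_errors ::
  "('a::finite list \<Rightarrow> real) \<Rightarrow> ('a list \<Rightarrow> 'a) \<Rightarrow> nat \<Rightarrow> real" where
  "expected_errors \<mu> \<theta> n =
     (\<Sum>t=1..n. word_expectation \<mu> (t - 1) (\<lambda>h. 1 - next_prob \<mu> h (\<theta> h)))"

definition expected_disagreements ::
  "('a::finite list \<Rightarrow> real) \<Rightarrow> ('a list \<Rightarrow> 'a) \<Rightarrow> ('a list \<Rightarrow> 'a) \<Rightarrow> nat \<Rightarrow> real" where
  "expected_disagreements \<mu> \<theta> \<theta>' n =
     (\<Sum>t=1..n. word_expectation \<mu> (t - 1) (\<lambda>h. if \<theta> h \<noteq> \<theta>' h then 1 else 0))"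

definition square_distance ::
  "('a::finite list \<Rightarrow> real) \<Rightarrow> ('a list \<Rightarrow> real) \<Rightarrow> nat \<Rightarrow> real" where
  "square_distance \<mu> \<xi> n =
     (\<Sum>t=1..n. word_expectation \<mu> (t - 1)
        (\<lambda>h. \<Sum>a\<in>UNIV. (next_prob \<mu> h a - next_prob \<xi> h a)\<^sup>2))"

definition absolute_distance ::
  "('a::finite list \<Rightarrow> real) \<Rightarrow> ('a list \<Rightarrow> real) \<Rightarrow> nat \<Rightarrow> real" where
  "absolute_distance \<mu> \<xi> n =
     1 / 2 * (\<Sum>t=1..n. word_expectation \<mu> (t - 1)
        (\<lambda>h. (\<Sum>a\<in>UNIV. \<bar>next_prob \<mu> h a - next_prob \<xi> h a\<bar>)\<^sup>2))"

text \<open>Words with \<open>\<mu> x = 0\<close> contribute \<open>0\<close>, whatever the value of the logarithm.\<close>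

definition relative_entropy ::
  "('a::finite list \<Rightarrow> real) \<Rightarrow> ('a list \<Rightarrow> real) \<Rightarrow> nat \<Rightarrow> real" where
  "relative_entropy \<mu> \<xi> n = word_expectation \<mu> n (\<lambda>x. ln (\<mu> x / \<xi> x))"

end

theory Submission
  imports Defs
begin

text \<open>
  After a history where the two predictors disagree, the excess error probability is at most
  \<open>(\<mu> j - \<xi> j) - (\<mu> i - \<xi> i)\<close> with \<open>i\<close>, \<open>j\<close> the two predictions, because \<open>i\<close> maximises \<open>\<xi>\<close>;
  this is at most \<open>sqrt 2\<close> times the Euclidean distance. Cauchy-Schwarz over all histories at
  once gives the bound \<open>sqrt (2 * Q * S)\<close>. A disagreement also forces the two error
  probabilities to add up to at least \<open>1\<close>, so \<open>Q\<close> is at most the total number of errors, and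
  solving the resulting quadratic inequality for the error gap gives the remaining error bounds.
  The comparison of the distances holds history by history, its last step being Pinsker's
  inequality and the chain rule for relative entropy; finally \<open>\<xi>\<close> dominates \<open>w \<mu> * \<mu>\<close>.
\<close>

section \<open>Inequalities between probability vectors\<close>

lemma deriv_sign_nonneg:
  fixes f f' :: "real \<Rightarrow> real"
  assumes deriv: "\<And>x. x > 0 \<Longrightarrow> (f has_real_derivative f' x) (at x)"
    and neg: "\<And>x. 0 < x \<Longrightarrow> x \<le> 1 \<Longrightarrow> f' x \<le> 0"
    and pos: "\<And>x. x \<ge> 1 \<Longrightarrow> f' x \<ge> 0"
    and "f 1 = 0" "x > 0"
  shows "f x \<ge> 0"
proof (cases "x \<le> 1")
  case True
  have "f 1 \<le> f x"
  proof (rule DERIV_nonpos_imp_nonincreasing[OF True])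
    fix y :: real assume "x \<le> y" "y \<le> 1"
    then show "\<exists>d. (f has_real_derivative d) (at y) \<and> d \<le> 0"
      using deriv[of y] neg[of y] \<open>x > 0\<close> by auto
  qed
  then show ?thesis using \<open>f 1 = 0\<close> by simp
next
  case False
  then have "1 \<le> x" by simp
  have "f 1 \<le> f x"
  proof (rule DERIV_nonneg_imp_nondecreasing[OF \<open>1 \<le> x\<close>])
    fix y :: real assume "1 \<le> y"
    then show "\<exists>d. (f has_real_derivative d) (at y) \<and> d \<ge> 0"
      using deriv[of y] pos[of y] by auto
  qed
  then show ?thesis using \<open>f 1 = 0\<close> by simp
qed

text \<open>The left side is what remains when
  \<open>3 * (x - 1)^2 <= (4 + 2 * x) * (x * ln x - x + 1)\<close> is solved for
  \<open>ln x\<close>. Both sides agree at 1, and the derivative of the difference has the sign of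
  \<open>(x - 1) ^ 3\<close>.\<close>

lemma ln_ge_rational:
  fixes x :: real
  assumes "x > 0"
  shows "(x - 1) * (5 * x + 1) / (x * (4 + 2 * x)) \<le> ln x"
proof -
  let ?f = "\<lambda>x::real. ln x - (x - 1) * (5 * x + 1) / (x * (4 + 2 * x))"
  let ?f' = "\<lambda>x::real. (x - 1) ^ 3 / (x\<^sup>2 * (x + 2)\<^sup>2)"
  have "(?f has_real_derivative ?f' x) (at x)" if "x > 0" for x
  proof -
    have *: "x * (4 + 2 * x) \<noteq> 0" "x \<noteq> 0" "x + 2 \<noteq> 0" "4 + 2 * x \<noteq> 0" using that by auto
    have "(?f has_real_derivative 1 / x - (((5 * x + 1) + (x - 1) * 5) * (x * (4 + 2 * x))
        - (x - 1) * (5 * x + 1) * ((4 + 2 * x) + x * 2)) / (x * (4 + 2 * x))\<^sup>2) (at x)"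
      using that * by (auto intro!: derivative_eq_intros simp: power2_eq_square)
    also have "1 / x - (((5 * x + 1) + (x - 1) * 5) * (x * (4 + 2 * x))
        - (x - 1) * (5 * x + 1) * ((4 + 2 * x) + x * 2)) / (x * (4 + 2 * x))\<^sup>2 = ?f' x"
    proof -
      \<comment> \<open>All three fractions are brought over one denominator, using
        \<open>x * (4 + 2 * x) = 2 * x * (x + 2)\<close>; a polynomial identity between numerators
        remains.\<close>
      let ?d = "4 * (x\<^sup>2 * (x + 2)\<^sup>2)"
      have e: "(x * (4 + 2 * x))\<^sup>2 = ?d"
        by (simp add: power2_eq_square algebra_simps)
      have i: "1 / x = 4 * (x * (x + 2)\<^sup>2) / ?d"
        using * by (simp add: power2_eq_square)
      have f: "?f' x = 4 * (x - 1) ^ 3 / ?d" by simp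
      show ?thesis
        unfolding e i f diff_divide_distrib[symmetric]
        by (rule arg_cong[of _ _ "\<lambda>y. y / ?d"])
          (simp add: power2_eq_square power3_eq_cube algebra_simps)
    qed
    finally show ?thesis .
  qed
  then have "?f x \<ge> 0"
    by (rule deriv_sign_nonneg)
      (auto intro!: divide_nonpos_nonneg divide_nonneg_nonneg simp: assms)
  then show ?thesis by simp
qed

text \<open>Both sides are homogeneous of degree 2, so division by \<open>q\<^sup>2\<close> leaves
  an inequality in \<open>x = p / q\<close>, which is \<open>ln_ge_rational\<close> multiplied out.
  For \<open>p = 0\<close> the claim reads \<open>3 * q^2 <= 4 * q^2\<close>.\<close>

lemma sq_diff_le_relative_entropy_term:
  fixes p q :: real
  assumes "p \<ge> 0" "q \<ge> 0" "p > 0 \<Longrightarrow> q > 0"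
  shows "3 * (p - q)\<^sup>2 \<le> (4 * q + 2 * p) * (p * ln (p / q) - p + q)"
proof (cases "p = 0")
  case True
  then show ?thesis by (simp add: power2_eq_square)
next
  case False
  then have p: "p > 0" and q: "q > 0" using assms by auto
  define x where "x = p / q"
  have x: "x > 0" and px: "p = q * x" using p q by (auto simp: x_def)
  have "(x - 1) * (5 * x + 1) \<le> ln x * (x * (4 + 2 * x))"
    using ln_ge_rational[OF x] x by (simp add: pos_divide_le_eq)
  then have "q\<^sup>2 * (3 * (x - 1)\<^sup>2) \<le> q\<^sup>2 * ((4 + 2 * x) * (x * ln x - x + 1))"
    by (intro mult_left_mono) (auto simp: power2_eq_square algebra_simps)
  then show ?thesis
    unfolding x_def[symmetric] unfolding px by (simp add: power2_eq_square algebra_simps)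
qed

text \<open>
  Integrating the preceding pointwise bound with Cauchy-Schwarz works because the
  weights \<open>(4 * q + 2 * p) / 3\<close> add up to \<open>2\<close>.
\<close>

lemma Pinsker:
  fixes p q :: "'a \<Rightarrow> real"
  assumes "\<And>a. a \<in> A \<Longrightarrow> p a \<ge> 0" "\<And>a. a \<in> A \<Longrightarrow> q a \<ge> 0"
    and ac: "\<And>a. a \<in> A \<Longrightarrow> p a > 0 \<Longrightarrow> q a > 0"
    and sums: "sum p A = 1" "sum q A = 1"
  shows "1 / 2 * (\<Sum>a\<in>A. \<bar>p a - q a\<bar>)\<^sup>2 \<le> (\<Sum>a\<in>A. p a * ln (p a / q a))"
proof -
  define u where "u a = (4 * q a + 2 * p a) / 3" for a
  \<comment> \<open>The extra \<open>- p a + q a\<close> makes every \<open>v a\<close> nonnegative,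
    as the square roots below require, and cancels in the sum over \<open>A\<close>.\<close>
  define v where "v a = p a * ln (p a / q a) - p a + q a" for a
  have bound: "(p a - q a)\<^sup>2 \<le> u a * v a" if "a \<in> A" for a
    using sq_diff_le_relative_entropy_term[of "p a" "q a"] assms that
    by (simp add: u_def v_def)
  have nonneg: "u a \<ge> 0" "v a \<ge> 0" if "a \<in> A" for a
  proof -
    show "u a \<ge> 0" using assms that by (auto simp: u_def)
    show "v a \<ge> 0"
    proof (cases "u a > 0")
      case True
      have "0 \<le> u a * v a" using bound[OF that] by (meson order_trans zero_le_power2)
      then show ?thesis using True by (simp add: zero_le_mult_iff)
    next
      case False
      then have "p a = 0" "q a = 0" using assms(1,2)[OF that] by (auto simp: u_def)
      then show ?thesis by (simp add: v_def)
    qed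
  qed
  have "(\<Sum>a\<in>A. \<bar>p a - q a\<bar>) \<le> (\<Sum>a\<in>A. sqrt (u a) * sqrt (v a))"
    by (intro sum_mono) (metis bound real_le_rsqrt real_sqrt_mult power2_abs)
  then have "(\<Sum>a\<in>A. \<bar>p a - q a\<bar>)\<^sup>2 \<le> (\<Sum>a\<in>A. sqrt (u a) * sqrt (v a))\<^sup>2"
    by (intro power_mono) (auto intro: sum_nonneg)
  also have "\<dots> \<le> (\<Sum>a\<in>A. (sqrt (u a))\<^sup>2) * (\<Sum>a\<in>A. (sqrt (v a))\<^sup>2)"
    by (rule Cauchy_Schwarz_ineq_sum)
  also have "\<dots> = sum u A * sum v A"
    using nonneg by simp
  also have "sum u A = 2"
    using sums by (simp add: u_def sum.distrib flip: sum_divide_distrib sum_distrib_left)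
  also have "sum v A = (\<Sum>a\<in>A. p a * ln (p a / q a))"
    using sums by (simp add: v_def sum.distrib sum_subtractf)
  finally show ?thesis by simp
qed

text \<open>Entries summing to 0 balance: each one is minus the sum of the others, hence at most
  half of the absolute sum in size. Multiplying by its own absolute value and summing gives the
  claim.\<close>

lemma sum_squares_le_half_square_sum_abs:
  fixes d :: "'a \<Rightarrow> real"
  assumes "finite A" "sum d A = 0"
  shows "(\<Sum>a\<in>A. (d a)\<^sup>2) \<le> 1 / 2 * (\<Sum>a\<in>A. \<bar>d a\<bar>)\<^sup>2"
proof -
  let ?s = "\<Sum>a\<in>A. \<bar>d a\<bar>"
  have "\<bar>d a\<bar> \<le> ?s / 2" if "a \<in> A" for a
  proof -
    have "\<bar>d a\<bar> = \<bar>sum d (A - {a})\<bar>"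
      using assms that by (simp add: sum_diff1)
    also have "\<dots> \<le> (\<Sum>b\<in>A - {a}. \<bar>d b\<bar>)" by (rule sum_abs)
    also have "\<dots> = ?s - \<bar>d a\<bar>" using assms that by (simp add: sum_diff1)
    finally show ?thesis by simp
  qed
  then have "(\<Sum>a\<in>A. \<bar>d a\<bar> * \<bar>d a\<bar>) \<le> (\<Sum>a\<in>A. ?s / 2 * \<bar>d a\<bar>)"
    by (intro sum_mono mult_right_mono) auto
  also have "\<dots> = 1 / 2 * ?s\<^sup>2"
    unfolding sum_distrib_left[symmetric] by (simp add: power2_eq_square)
  finally show ?thesis by (simp add: power2_eq_square)
qed

text \<open>Adding \<open>q i - q j\<close>, which is nonnegative, turns the gap into a difference
  of two coordinate errors. The indicator sits inside the root so that Cauchy-Schwarz can later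
  separate disagreements from distances.\<close>

lemma maximiser_gap_le:
  fixes p q :: "'a::finite \<Rightarrow> real"
  assumes "q j \<le> q i"
  shows "p j - p i \<le> sqrt (2 * (if i \<noteq> j then 1 else 0) * (\<Sum>a\<in>UNIV. (p a - q a)\<^sup>2))"
proof (cases "i = j")
  case False
  have "(\<Sum>a\<in>{i, j}. (p a - q a)\<^sup>2) \<le> (\<Sum>a\<in>UNIV. (p a - q a)\<^sup>2)"
    by (rule sum_mono2) auto
  then have s: "(p i - q i)\<^sup>2 + (p j - q j)\<^sup>2 \<le> (\<Sum>a\<in>UNIV. (p a - q a)\<^sup>2)"
    using False by simp
  have "p j - p i \<le> (p j - q j) - (p i - q i)" using assms by simp
  also have "\<dots> \<le> sqrt (2 * ((p i - q i)\<^sup>2 + (p j - q j)\<^sup>2))"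
    using sum_squares_bound[of "p i - q i" "-(p j - q j)"]
    by (intro real_le_rsqrt) (simp add: power2_eq_square algebra_simps)
  also have "\<dots> \<le> sqrt (2 * (\<Sum>a\<in>UNIV. (p a - q a)\<^sup>2))" using s by simp
  finally show ?thesis using False by simp
qed simp

text \<open>Cauchy-Schwarz with each weight \<open>c x\<close> split into two square roots. Later
  the weights are the probabilities of all histories shorter than \<open>n\<close>.\<close>

lemma sum_mult_sqrt_le:
  fixes c f g :: "'a \<Rightarrow> real"
  assumes "\<And>x. x \<in> A \<Longrightarrow> c x \<ge> 0" "\<And>x. x \<in> A \<Longrightarrow> f x \<ge> 0" "\<And>x. x \<in> A \<Longrightarrow> g x \<ge> 0"
  shows "(\<Sum>x\<in>A. c x * sqrt (f x * g x)) \<le> sqrt ((\<Sum>x\<in>A. c x * f x) * (\<Sum>x\<in>A. c x * g x))"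
proof (rule real_le_rsqrt)
  have "(\<Sum>x\<in>A. c x * sqrt (f x * g x)) = (\<Sum>x\<in>A. sqrt (c x * f x) * sqrt (c x * g x))"
    using assms by (intro sum.cong) (auto simp: real_sqrt_mult)
  also have "\<dots>\<^sup>2 \<le> (\<Sum>x\<in>A. (sqrt (c x * f x))\<^sup>2) * (\<Sum>x\<in>A. (sqrt (c x * g x))\<^sup>2)"
    by (rule Cauchy_Schwarz_ineq_sum)
  also have "\<dots> = (\<Sum>x\<in>A. c x * f x) * (\<Sum>x\<in>A. c x * g x)"
    using assms by simp
  finally show "(\<Sum>x\<in>A. c x * sqrt (f x * g x))\<^sup>2 \<le> (\<Sum>x\<in>A. c x * f x) * (\<Sum>x\<in>A. c x * g x)" .
qed

section \<open>Distributions on words\<close>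

text \<open>Covers prefix probabilities of measures and mixtures alike, so that no measure on
  sequences has to be built for the mixture.\<close>

definition word_distribution :: "('a::finite list \<Rightarrow> real) \<Rightarrow> bool" where
  "word_distribution \<rho> \<longleftrightarrow>
     (\<forall>x. \<rho> x \<ge> 0) \<and> \<rho> [] = 1 \<and> (\<forall>h. (\<Sum>a\<in>UNIV. \<rho> (h @ [a])) = \<rho> h)"

lemma word_distributionD:
  assumes "word_distribution \<rho>"
  shows "\<rho> x \<ge> 0" "\<rho> [] = 1" "(\<Sum>a\<in>UNIV. \<rho> (h @ [a])) = \<rho> h"
  using assms by (auto simp: word_distribution_def)

lemma next_prob_nonneg: "word_distribution \<rho> \<Longrightarrow> next_prob \<rho> h a \<ge> 0"
  by (simp add: next_prob_def word_distributionD)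

lemma sum_next_prob:
  "word_distribution \<rho> \<Longrightarrow> \<rho> h > 0 \<Longrightarrow> (\<Sum>a\<in>UNIV. next_prob \<rho> h a) = 1"
  by (simp add: next_prob_def word_distributionD flip: sum_divide_distrib)

lemma next_prob_sum_le_1:
  assumes "word_distribution \<rho>" "\<rho> h > 0" "i \<noteq> j"
  shows "next_prob \<rho> h i + next_prob \<rho> h j \<le> 1"
proof -
  have "(\<Sum>a\<in>{i, j}. next_prob \<rho> h a) \<le> (\<Sum>a\<in>UNIV. next_prob \<rho> h a)"
    by (rule sum_mono2) (auto simp: next_prob_nonneg assms)
  then show ?thesis using assms by (simp add: sum_next_prob)
qed

lemma next_prob_le_1:
  assumes "word_distribution \<rho>"
  shows "next_prob \<rho> h a \<le> 1"
proof (cases "\<rho> h > 0")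
  case True
  have "next_prob \<rho> h a \<le> (\<Sum>a\<in>UNIV. next_prob \<rho> h a)"
    by (rule member_le_sum) (auto simp: next_prob_nonneg assms)
  then show ?thesis using assms True by (simp add: sum_next_prob)
next
  case False
  then have "\<rho> h = 0" using word_distributionD(1)[OF assms, of h] by simp
  then show ?thesis by (simp add: next_prob_def)
qed

section \<open>Expectations over histories of bounded length\<close>

lemma finite_words: "finite {x :: 'a::finite list. length x = k}"
  using finite_lists_length_eq[of "UNIV :: 'a set" k] by simp

text \<open>Histories of different lengths are disjoint, so time and history merge into one index. A
  single Cauchy-Schwarz step then covers all \<open>n\<close> predictions.\<close>

lemma sum_word_expectation:
  fixes \<mu> :: "'a::finite list \<Rightarrow> real"
  shows "(\<Sum>t=1..n. word_expectation \<mu> (t - 1) f) = (\<Sum>h | length h < n. \<mu> h * f h)"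
proof -
  have "(\<Sum>t=1..n. word_expectation \<mu> (t - 1) f) = (\<Sum>k<n. word_expectation \<mu> k f)"
    by (rule sum.reindex_bij_witness[of _ Suc "\<lambda>t. t - 1"]) auto
  also have "\<dots> = (\<Sum>h\<in>(\<Union>k<n. {x. length x = k}). \<mu> h * f h)"
    unfolding word_expectation_def by (rule sum.UNION_disjoint[symmetric]) (auto simp: finite_words)
  also have "(\<Union>k<n. {x. length x = k}) = {h :: 'a list. length h < n}" by auto
  finally show ?thesis .
qed

lemma word_expectation_Suc:
  "word_expectation \<mu> (Suc k) f =
     (\<Sum>h | length h = k. \<Sum>a\<in>UNIV. \<mu> (h @ [a]) * f (h @ [a]))"
proof -
  have "word_expectation \<mu> (Suc k) f =
      (\<Sum>(h, a)\<in>{h. length h = k} \<times> UNIV. \<mu> (h @ [a]) * f (h @ [a]))"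
    unfolding word_expectation_def
    by (rule sum.reindex_bij_witness[of _ "\<lambda>(h, a). h @ [a]" "\<lambda>x. (butlast x, last x)"])
      (auto simp: append_butlast_last_id simp flip: length_greater_0_conv)
  then show ?thesis by (simp add: sum.cartesian_product)
qed

lemma word_expectation_one:
  assumes "word_distribution \<mu>"
  shows "word_expectation \<mu> k (\<lambda>_. 1) = 1"
proof (induction k)
  case (Suc k)
  then show ?case
    unfolding word_expectation_Suc using assms
    by (simp add: word_distributionD) (simp add: word_expectation_def)
qed (simp add: word_expectation_def word_distributionD assms)

text \<open>Impossible histories carry weight 0, so comparisons are required only where the
  conditional probabilities of \<open>\<mu>\<close> sum to 1.\<close>

lemma word_expectation_mono:
  assumes "word_distribution \<mu>" "\<And>h. \<mu> h > 0 \<Longrightarrow> f h \<le> g h"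
  shows "word_expectation \<mu> k f \<le> word_expectation \<mu> k g"
  unfolding word_expectation_def
proof (rule sum_mono)
  fix h
  show "\<mu> h * f h \<le> \<mu> h * g h"
    using assms(2)[of h] word_distributionD(1)[OF assms(1), of h]
    by (cases "\<mu> h = 0") (auto intro: mult_left_mono)
qed

text \<open>Chain rule: the likelihood ratio of \<open>h @ [a]\<close> is that of \<open>h\<close>
  times the ratio of conditional probabilities, and the logarithm turns this into a sum.\<close>

lemma relative_entropy_Suc:
  assumes \<mu>: "word_distribution \<mu>" and ac: "\<And>x. \<mu> x > 0 \<Longrightarrow> \<xi> x > 0"
  shows "relative_entropy \<mu> \<xi> (Suc k) = relative_entropy \<mu> \<xi> k + word_expectation \<mu> k
    (\<lambda>h. \<Sum>a\<in>UNIV. next_prob \<mu> h a * ln (next_prob \<mu> h a / next_prob \<xi> h a))"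
proof -
  have step: "\<mu> (h @ [a]) * ln (\<mu> (h @ [a]) / \<xi> (h @ [a])) = \<mu> (h @ [a]) * ln (\<mu> h / \<xi> h)
      + \<mu> h * (next_prob \<mu> h a * ln (next_prob \<mu> h a / next_prob \<xi> h a))" for h a
  proof (cases "\<mu> (h @ [a]) = 0")
    case False
    \<comment> \<open>A possible word has a possible prefix, by consistency, and \<open>ac\<close>
      carries both to \<open>\<xi>\<close>, so all logarithms split.\<close>
    then have pos: "\<mu> (h @ [a]) > 0" using word_distributionD(1)[OF \<mu>, of "h @ [a]"] by simp
    also have "\<mu> (h @ [a]) \<le> (\<Sum>a\<in>UNIV. \<mu> (h @ [a]))"
      by (rule member_le_sum) (auto simp: word_distributionD[OF \<mu>])
    finally have posh: "\<mu> h > 0" by (simp add: word_distributionD[OF \<mu>])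
    show ?thesis
      using pos posh ac[OF pos] ac[OF posh]
      by (simp add: next_prob_def ln_div ln_mult algebra_simps)
  qed (simp add: next_prob_def)
  show ?thesis
    \<comment> \<open>In the first summand the last letter is summed out by consistency, which
      leaves the entropy at \<open>k\<close>.\<close>
    unfolding relative_entropy_def word_expectation_Suc step sum.distrib
    unfolding word_expectation_def
    by (simp add: word_distributionD[OF \<mu>] flip: sum_distrib_left sum_distrib_right)
qed

lemma absolute_distance_Suc:
  "absolute_distance \<mu> \<xi> (Suc n) = absolute_distance \<mu> \<xi> n + word_expectation \<mu> n
     (\<lambda>h. 1 / 2 * (\<Sum>a\<in>UNIV. \<bar>next_prob \<mu> h a - next_prob \<xi> h a\<bar>)\<^sup>2)"
  unfolding absolute_distance_def
  by (simp add: word_expectation_def sum_distrib_left algebra_simps)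

section \<open>Comparison of the distances\<close>

text \<open>After a history possible under \<open>\<mu>\<close>, hence under \<open>\<xi>\<close> by
  \<open>ac\<close>, both conditional vectors sum to 1, so their difference sums to 0.\<close>

lemma square_distance_le_absolute_distance:
  assumes "word_distribution \<mu>" "word_distribution \<xi>" and ac: "\<And>x. \<mu> x > 0 \<Longrightarrow> \<xi> x > 0"
  shows "square_distance \<mu> \<xi> n \<le> absolute_distance \<mu> \<xi> n"
proof -
  have "word_expectation \<mu> k (\<lambda>h. \<Sum>a\<in>UNIV. (next_prob \<mu> h a - next_prob \<xi> h a)\<^sup>2) \<le>
      word_expectation \<mu> k
        (\<lambda>h. 1 / 2 * (\<Sum>a\<in>UNIV. \<bar>next_prob \<mu> h a - next_prob \<xi> h a\<bar>)\<^sup>2)" for k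
    using assms by (intro word_expectation_mono sum_squares_le_half_square_sum_abs)
      (auto simp: sum_subtractf sum_next_prob)
  then have "square_distance \<mu> \<xi> n \<le> (\<Sum>t=1..n. word_expectation \<mu> (t - 1)
        (\<lambda>h. 1 / 2 * (\<Sum>a\<in>UNIV. \<bar>next_prob \<mu> h a - next_prob \<xi> h a\<bar>)\<^sup>2))"
    unfolding square_distance_def by (rule sum_mono)
  also have "\<dots> = absolute_distance \<mu> \<xi> n"
    unfolding absolute_distance_def word_expectation_def
    by (simp add: sum_distrib_left mult.left_commute)
  finally show ?thesis .
qed

text \<open>By induction: both sides gain one expectation per step, and Pinsker's inequality
  compares the gains history by history.\<close>

lemma absolute_distance_le_relative_entropy:
  assumes \<mu>: "word_distribution \<mu>" and \<xi>: "word_distribution \<xi>"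
    and ac: "\<And>x. \<mu> x > 0 \<Longrightarrow> \<xi> x > 0"
  shows "absolute_distance \<mu> \<xi> n \<le> relative_entropy \<mu> \<xi> n"
proof (induction n)
  case 0
  show ?case
    by (simp add: absolute_distance_def relative_entropy_def word_expectation_def
        word_distributionD[OF \<mu>] word_distributionD[OF \<xi>])
next
  case (Suc n)
  have "word_expectation \<mu> n
      (\<lambda>h. 1 / 2 * (\<Sum>a\<in>UNIV. \<bar>next_prob \<mu> h a - next_prob \<xi> h a\<bar>)\<^sup>2) \<le> word_expectation \<mu> n
      (\<lambda>h. \<Sum>a\<in>UNIV. next_prob \<mu> h a * ln (next_prob \<mu> h a / next_prob \<xi> h a))"
  proof (intro word_expectation_mono[OF \<mu>] Pinsker)
    fix h a assume h: "\<mu> h > 0" and "next_prob \<mu> h a > 0"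
    then show "next_prob \<xi> h a > 0"
      using ac[of h] ac[of "h @ [a]"] by (simp add: next_prob_def zero_less_divide_iff)
  qed (auto simp: next_prob_nonneg sum_next_prob \<mu> \<xi> ac)
  moreover have "relative_entropy \<mu> \<xi> (Suc n) = relative_entropy \<mu> \<xi> n + word_expectation \<mu> n
      (\<lambda>h. \<Sum>a\<in>UNIV. next_prob \<mu> h a * ln (next_prob \<mu> h a / next_prob \<xi> h a))"
    by (rule relative_entropy_Suc[OF \<mu> ac])
  ultimately show ?case
    using Suc unfolding absolute_distance_Suc by linarith
qed

text \<open>Domination bounds the log-likelihood ratio on each possible word; averaging keeps the
  bound since words of length \<open>n\<close> have total mass 1.\<close>

lemma relative_entropy_le_ln_inverse:
  assumes \<mu>: "word_distribution \<mu>" and c: "c > 0" and dom: "\<And>x. c * \<mu> x \<le> \<xi> x"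
  shows "relative_entropy \<mu> \<xi> n \<le> ln (inverse c)"
proof -
  have "ln (\<mu> x / \<xi> x) \<le> ln (inverse c)" if "\<mu> x > 0" for x
  proof -
    have "\<xi> x > 0" using dom[of x] c that by (meson less_le_trans mult_pos_pos)
    then have "\<mu> x / \<xi> x \<le> inverse c" "\<mu> x / \<xi> x > 0"
      using dom[of x] c that by (auto simp: field_simps)
    then show ?thesis by (meson ln_mono)
  qed
  then have "relative_entropy \<mu> \<xi> n \<le> word_expectation \<mu> n (\<lambda>_. ln (inverse c))"
    unfolding relative_entropy_def by (rule word_expectation_mono[OF \<mu>])
  also have "\<dots> = word_expectation \<mu> n (\<lambda>_. 1) * ln (inverse c)"
    by (simp add: word_expectation_def sum_distrib_right)
  finally show ?thesis using word_expectation_one[OF \<mu>] by simp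
qed

section \<open>Error bounds\<close>

lemma predictor_next_prob_le: "is_predictor \<rho> \<theta> \<Longrightarrow> next_prob \<rho> h a \<le> next_prob \<rho> h (\<theta> h)"
  by (simp add: is_predictor_def is_arg_max_def not_less)

lemma expected_errors_diff:
  "expected_errors \<mu> \<theta> n - expected_errors \<mu> \<theta>' n =
     (\<Sum>h | length h < n. \<mu> h * (next_prob \<mu> h (\<theta>' h) - next_prob \<mu> h (\<theta> h)))"
  unfolding expected_errors_def sum_word_expectation sum_subtractf[symmetric]
  by (simp add: algebra_simps)

lemma expected_errors_nonneg: "word_distribution \<mu> \<Longrightarrow> expected_errors \<mu> \<theta> n \<ge> 0"
  unfolding expected_errors_def sum_word_expectation
  by (intro sum_nonneg mult_nonneg_nonneg) (auto simp: word_distributionD next_prob_le_1)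

lemma square_distance_nonneg: "word_distribution \<mu> \<Longrightarrow> square_distance \<mu> \<xi> n \<ge> 0"
  unfolding square_distance_def sum_word_expectation
  by (intro sum_nonneg mult_nonneg_nonneg) (auto simp: word_distributionD)

text \<open>\<open>\<theta>\<^sub>\<mu>\<close> is best after each single history, so every term of
  the gap is nonnegative.\<close>

lemma expected_errors_optimal:
  assumes "word_distribution \<mu>" "is_predictor \<mu> \<theta>\<^sub>\<mu>"
  shows "expected_errors \<mu> \<theta>\<^sub>\<mu> n \<le> expected_errors \<mu> \<theta> n"
proof -
  have "0 \<le> expected_errors \<mu> \<theta> n - expected_errors \<mu> \<theta>\<^sub>\<mu> n"
    unfolding expected_errors_diff using assms
    by (intro sum_nonneg mult_nonneg_nonneg) (auto simp: word_distributionD predictor_next_prob_le)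
  then show ?thesis by simp
qed

lemma expected_errors_gap_le:
  assumes \<mu>: "word_distribution \<mu>" and \<theta>: "is_predictor \<xi> \<theta>"
  shows "expected_errors \<mu> \<theta> n - expected_errors \<mu> \<theta>' n \<le>
    sqrt (2 * expected_disagreements \<mu> \<theta> \<theta>' n * square_distance \<mu> \<xi> n)"
proof -
  \<comment> \<open>The factor 2 stays with the indicator, so that the other factor after
    Cauchy-Schwarz is exactly the squared distance.\<close>
  let ?q = "\<lambda>h. 2 * (if \<theta> h \<noteq> \<theta>' h then 1 else 0) :: real"
  let ?s = "\<lambda>h. \<Sum>a\<in>UNIV. (next_prob \<mu> h a - next_prob \<xi> h a)\<^sup>2"
  have "expected_errors \<mu> \<theta> n - expected_errors \<mu> \<theta>' n \<le>
      (\<Sum>h | length h < n. \<mu> h * sqrt (?q h * ?s h))"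
    unfolding expected_errors_diff
    by (intro sum_mono mult_left_mono maximiser_gap_le predictor_next_prob_le[OF \<theta>]
        word_distributionD(1)[OF \<mu>])
  also have "\<dots> \<le> sqrt ((\<Sum>h | length h < n. \<mu> h * ?q h) * (\<Sum>h | length h < n. \<mu> h * ?s h))"
    by (rule sum_mult_sqrt_le) (auto intro: sum_nonneg simp: word_distributionD[OF \<mu>])
  also have "(\<Sum>h | length h < n. \<mu> h * ?q h) = 2 * expected_disagreements \<mu> \<theta> \<theta>' n"
    unfolding expected_disagreements_def sum_word_expectation
    by (simp add: sum_distrib_left mult.left_commute)
  also have "(\<Sum>h | length h < n. \<mu> h * ?s h) = square_distance \<mu> \<xi> n"
    unfolding square_distance_def sum_word_expectation ..
  finally show ?thesis .
qed

lemma expected_disagreements_le: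
  assumes \<mu>: "word_distribution \<mu>"
  shows "expected_disagreements \<mu> \<theta> \<theta>' n \<le> expected_errors \<mu> \<theta> n + expected_errors \<mu> \<theta>' n"
proof -
  have "(if \<theta> h \<noteq> \<theta>' h then 1 else 0) \<le> (1 - next_prob \<mu> h (\<theta> h)) + (1 - next_prob \<mu> h (\<theta>' h))"
    if "\<mu> h > 0" for h
    \<comment> \<open>Different predictions share probability at most 1; for equal ones the left
      side is 0 and the right side nonnegative.\<close>
    using next_prob_sum_le_1[OF \<mu> that, of "\<theta> h" "\<theta>' h"]
      next_prob_le_1[OF \<mu>, of h "\<theta> h"] next_prob_le_1[OF \<mu>, of h "\<theta>' h"] by auto
  then have "expected_disagreements \<mu> \<theta> \<theta>' n \<le> (\<Sum>t=1..n. word_expectation \<mu> (t - 1)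
      (\<lambda>h. (1 - next_prob \<mu> h (\<theta> h)) + (1 - next_prob \<mu> h (\<theta>' h))))"
    unfolding expected_disagreements_def by (intro sum_mono word_expectation_mono[OF \<mu>])
  also have "\<dots> = expected_errors \<mu> \<theta> n + expected_errors \<mu> \<theta>' n"
    unfolding expected_errors_def sum_word_expectation sum.distrib[symmetric] distrib_left[symmetric] ..
  finally show ?thesis .
qed

text \<open>Here \<open>d\<close> is the error gap, \<open>e\<close> the optimal error and
  \<open>s\<close> the squared distance. With \<open>r\<close> the root, \<open>d \<le> r\<close>
  gives \<open>r^2 <= 2 * r * s + 4 * e * s\<close>; completing the square bounds
  \<open>r - s\<close>.\<close>

lemma sqrt_bound_resolve:
  fixes d e s :: real
  assumes "d \<ge> 0" "e \<ge> 0" "s \<ge> 0" "d \<le> sqrt (2 * (d + 2 * e) * s)"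
  shows "sqrt (2 * (d + 2 * e) * s) \<le> s + sqrt (4 * e * s + s\<^sup>2)"
proof -
  define r where "r = sqrt (2 * (d + 2 * e) * s)"
  have "r\<^sup>2 = 2 * d * s + 4 * e * s" using assms by (simp add: r_def algebra_simps)
  also have "\<dots> \<le> 2 * r * s + 4 * e * s" using assms by (simp add: r_def mult_right_mono)
  finally have "(r - s)\<^sup>2 \<le> 4 * e * s + s\<^sup>2" by (simp add: power2_diff)
  then have "r - s \<le> sqrt (4 * e * s + s\<^sup>2)" by (rule real_le_rsqrt)
  then show ?thesis by (simp add: r_def)
qed

lemma sqrt_four_mult_add_square_le:
  fixes e s :: real
  assumes "e \<ge> 0" "s \<ge> 0"
  shows "s + sqrt (4 * e * s + s\<^sup>2) \<le> 2 * s + 2 * sqrt (e * s)"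
proof -
  have "sqrt (4 * e * s + s\<^sup>2) \<le> sqrt (4 * e * s) + sqrt (s\<^sup>2)"
    using assms by (intro sqrt_add_le_add_sqrt) auto
  also have "\<dots> = 2 * sqrt (e * s) + s"
    using assms by (simp add: real_sqrt_mult)
  finally show ?thesis by simp
qed

section \<open>Mixtures\<close>

text \<open>Lets the finite sum over letters pass through the infinite sum that defines a
  mixture.\<close>

lemma has_sum_finite_sum:
  fixes f :: "'i \<Rightarrow> 'b \<Rightarrow> 'c::topological_comm_monoid_add"
  assumes "finite I" "\<And>i. i \<in> I \<Longrightarrow> (f i has_sum s i) A"
  shows "((\<lambda>x. \<Sum>i\<in>I. f i x) has_sum (\<Sum>i\<in>I. s i)) A"
  using assms by (induction I rule: finite_induct) (auto intro: has_sum_add)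

text \<open>The cylinder of \<open>h\<close> is the disjoint union of the cylinders of its
  one-letter extensions, finitely many because the alphabet is finite.\<close>

lemma word_distribution_prefix_prob:
  fixes \<rho> :: "'a::finite stream measure"
  assumes "sequence_distribution \<rho>"
  shows "word_distribution (prefix_prob \<rho>)"
proof -
  interpret prob_space \<rho> using assms by (simp add: sequence_distribution_def)
  have sets: "sets \<rho> = sets (stream_space (count_space UNIV))"
    using assms by (simp add: sequence_distribution_def)
  have space: "space \<rho> = UNIV"
    using sets_eq_imp_space_eq[OF sets] by (simp add: space_stream_space)
  have meas: "{\<omega>. stake (length x) \<omega> = x} \<in> sets \<rho>" for x :: "'a list"
  proof -
    have "{\<omega> \<in> space (stream_space (count_space UNIV)). stake (length x) \<omega> = x}
        \<in> sets (stream_space (count_space (UNIV :: 'a set)))" by measurable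
    then show ?thesis by (simp add: sets space_stream_space)
  qed
  have "(\<Sum>a\<in>UNIV. prefix_prob \<rho> (h @ [a])) = prefix_prob \<rho> h" for h
  proof -
    have "(\<Sum>a\<in>UNIV. prefix_prob \<rho> (h @ [a])) =
        measure \<rho> (\<Union>a\<in>UNIV. {\<omega>. stake (length (h @ [a])) \<omega> = h @ [a]})"
      unfolding prefix_prob_def space
      by (subst finite_measure_finite_Union)
        (auto simp: disjoint_family_on_def intro!: meas simp del: length_append,
          simp del: stake.simps)
    also have "(\<Union>a\<in>UNIV. {\<omega>. stake (length (h @ [a])) \<omega> = h @ [a]}) = {\<omega>. stake (length h) \<omega> = h}"
      by (auto simp: stake_Suc simp del: stake.simps)
    finally show ?thesis by (simp add: prefix_prob_def space)
  qed
  moreover have "prefix_prob \<rho> [] = 1"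
    using prob_space by (simp add: prefix_prob_def)
  ultimately show ?thesis
    by (simp add: word_distribution_def) (simp add: prefix_prob_def)
qed

section \<open>Convergence, consistency and domination of the mixture\<close>

lemma prefix_prob_le_1:
  assumes "sequence_distribution \<rho>"
  shows "prefix_prob \<rho> x \<le> 1"
proof -
  interpret prob_space \<rho> using assms by (simp add: sequence_distribution_def)
  show ?thesis by (simp add: prefix_prob_def)
qed

text \<open>Infinite sums without convergence default to 0, so this gives \<open>mixture\<close> its
  intended value. Since prefix probabilities are at most 1, \<open>w\<close> is a majorant.\<close>

lemma mixture_summable:
  fixes M :: "'a::finite stream measure set"
  assumes M: "\<And>\<nu>. \<nu> \<in> M \<Longrightarrow> sequence_distribution \<nu>"
    and w: "\<And>\<nu>. \<nu> \<in> M \<Longrightarrow> w \<nu> \<ge> 0" and sum: "w summable_on M"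
  shows "(\<lambda>\<nu>. w \<nu> * prefix_prob \<nu> x) summable_on M"
proof (rule summable_on_comparison_test[OF sum])
  fix \<nu> assume "\<nu> \<in> M"
  then show "w \<nu> * prefix_prob \<nu> x \<le> w \<nu>" "0 \<le> w \<nu> * prefix_prob \<nu> x"
    using w[of \<nu>] prefix_prob_le_1[OF M, of \<nu> x]
      word_distributionD(1)[OF word_distribution_prefix_prob[OF M], of \<nu> x]
    by (auto intro: mult_left_le)
qed

lemma word_distribution_mixture:
  fixes M :: "'a::finite stream measure set"
  assumes M: "\<And>\<nu>. \<nu> \<in> M \<Longrightarrow> sequence_distribution \<nu>"
    and w: "\<And>\<nu>. \<nu> \<in> M \<Longrightarrow> w \<nu> \<ge> 0" and sum: "(w has_sum 1) M"
  shows "word_distribution (mixture M w)"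
proof -
  note D = word_distributionD[OF word_distribution_prefix_prob[OF M]]
  have sb: "(\<lambda>\<nu>. w \<nu> * prefix_prob \<nu> x) summable_on M" for x
    using mixture_summable[OF M w has_sum_imp_summable[OF sum]] .
  have "mixture M w x \<ge> 0" for x
    unfolding mixture_def using w D(1) by (intro infsum_nonneg) auto
  moreover have "mixture M w [] = infsum w M"
    unfolding mixture_def by (rule infsum_cong) (simp add: D(2))
  moreover have "(\<Sum>a\<in>UNIV. mixture M w (h @ [a])) = mixture M w h" for h
  proof -
    have "(\<Sum>a\<in>UNIV. mixture M w (h @ [a])) =
        (\<Sum>\<^sub>\<infinity>\<nu>\<in>M. \<Sum>a\<in>UNIV. w \<nu> * prefix_prob \<nu> (h @ [a]))"
      unfolding mixture_def
      by (rule infsumI[symmetric], rule has_sum_finite_sum) (simp_all add: sb)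
    also have "\<dots> = mixture M w h"
      unfolding mixture_def
      by (rule infsum_cong) (simp add: D(3) flip: sum_distrib_left)
    finally show ?thesis .
  qed
  ultimately show ?thesis
    using infsumI[OF sum] by (simp add: word_distribution_def)
qed

text \<open>A single term of a convergent nonnegative series is at most its value.\<close>

lemma mixture_dominates:
  fixes M :: "'a::finite stream measure set"
  assumes M: "\<And>\<nu>. \<nu> \<in> M \<Longrightarrow> sequence_distribution \<nu>"
    and w: "\<And>\<nu>. \<nu> \<in> M \<Longrightarrow> w \<nu> \<ge> 0" and sum: "w summable_on M" and \<mu>: "\<mu> \<in> M"
  shows "w \<mu> * prefix_prob \<mu> x \<le> mixture M w x"
proof -
  have "(\<Sum>\<nu>\<in>{\<mu>}. w \<nu> * prefix_prob \<nu> x) \<le> (\<Sum>\<^sub>\<infinity>\<nu>\<in>M. w \<nu> * prefix_prob \<nu> x)"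
    using \<mu> w word_distributionD(1)[OF word_distribution_prefix_prob[OF M]]
    by (intro finite_sum_le_infsum mixture_summable[OF M w sum]) auto
  then show ?thesis by (simp add: mixture_def)
qed

theorem theorem2:
  fixes M :: "'a::finite stream measure set"
    and w :: "'a stream measure \<Rightarrow> real"
    and \<mu> :: "'a stream measure"
    and \<theta>\<^sub>\<xi> \<theta>\<^sub>\<mu> :: "'a list \<Rightarrow> 'a"
    and n :: nat
  assumes "countable M"
    and "\<And>\<nu>. \<nu> \<in> M \<Longrightarrow> sequence_distribution \<nu>"
    and "\<And>\<nu>. \<nu> \<in> M \<Longrightarrow> w \<nu> > 0"
    and "(w has_sum 1) M"
    and "\<mu> \<in> M"
    and "is_predictor (mixture M w) \<theta>\<^sub>\<xi>"
    and "is_predictor (prefix_prob \<mu>) \<theta>\<^sub>\<mu>"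
  shows
    "let m = prefix_prob \<mu>;
         \<xi> = mixture M w;
         E\<^sub>\<xi> = expected_errors m \<theta>\<^sub>\<xi> n;
         E\<^sub>\<mu> = expected_errors m \<theta>\<^sub>\<mu> n;
         Q = expected_disagreements m \<theta>\<^sub>\<xi> \<theta>\<^sub>\<mu> n;
         S = square_distance m \<xi> n;
         V = absolute_distance m \<xi> n;
         D = relative_entropy m \<xi> n
     in 0 \<le> E\<^sub>\<xi> - E\<^sub>\<mu>
        \<and> E\<^sub>\<xi> - E\<^sub>\<mu> \<le> sqrt (2 * Q * S)
        \<and> sqrt (2 * Q * S) \<le> sqrt (2 * (E\<^sub>\<xi> + E\<^sub>\<mu>) * S)
        \<and> sqrt (2 * (E\<^sub>\<xi> + E\<^sub>\<mu>) * S) \<le> S + sqrt (4 * E\<^sub>\<mu> * S + S\<^sup>2)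
        \<and> S + sqrt (4 * E\<^sub>\<mu> * S + S\<^sup>2) \<le> 2 * S + 2 * sqrt (E\<^sub>\<mu> * S)
        \<and> S \<le> V \<and> V \<le> D \<and> D \<le> ln (inverse (w \<mu>))"
proof -
  let ?m = "prefix_prob \<mu>" and ?\<xi> = "mixture M w"
  have w: "w \<nu> \<ge> 0" if "\<nu> \<in> M" for \<nu> using assms(3)[OF that] by simp
  have \<mu>: "word_distribution ?m"
    by (rule word_distribution_prefix_prob[OF assms(2)[OF assms(5)]])
  have \<xi>: "word_distribution ?\<xi>"
    by (rule word_distribution_mixture[OF assms(2) w assms(4)])
  have dom: "w \<mu> * ?m x \<le> ?\<xi> x" for x
    by (rule mixture_dominates[OF assms(2) w has_sum_imp_summable[OF assms(4)] assms(5)])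
  \<comment> \<open>Positivity passes to the mixture because the weight of \<open>\<mu>\<close> is
    positive.\<close>
  have ac: "?\<xi> x > 0" if "?m x > 0" for x
    using dom[of x] assms(3)[OF assms(5)] that by (meson less_le_trans mult_pos_pos)
  define E\<^sub>\<xi> where "E\<^sub>\<xi> = expected_errors ?m \<theta>\<^sub>\<xi> n"
  define E\<^sub>\<mu> where "E\<^sub>\<mu> = expected_errors ?m \<theta>\<^sub>\<mu> n"
  define Q where "Q = expected_disagreements ?m \<theta>\<^sub>\<xi> \<theta>\<^sub>\<mu> n"
  define S where "S = square_distance ?m ?\<xi> n"
  have E\<^sub>\<mu>: "E\<^sub>\<mu> \<ge> 0" unfolding E\<^sub>\<mu>_def by (rule expected_errors_nonneg[OF \<mu>])
  have S: "S \<ge> 0" unfolding S_def by (rule square_distance_nonneg[OF \<mu>])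
  have opt: "0 \<le> E\<^sub>\<xi> - E\<^sub>\<mu>"
    unfolding E\<^sub>\<xi>_def E\<^sub>\<mu>_def using expected_errors_optimal[OF \<mu> assms(7)] by simp
  have gap: "E\<^sub>\<xi> - E\<^sub>\<mu> \<le> sqrt (2 * Q * S)"
    unfolding E\<^sub>\<xi>_def E\<^sub>\<mu>_def Q_def S_def by (rule expected_errors_gap_le[OF \<mu> assms(6)])
  have "Q \<le> E\<^sub>\<xi> + E\<^sub>\<mu>"
    unfolding E\<^sub>\<xi>_def E\<^sub>\<mu>_def Q_def by (rule expected_disagreements_le[OF \<mu>])
  then have QE: "sqrt (2 * Q * S) \<le> sqrt (2 * (E\<^sub>\<xi> + E\<^sub>\<mu>) * S)"
    using S by (intro real_sqrt_le_mono mult_right_mono) auto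
  \<comment> \<open>This puts the total error into the form \<open>d + 2 * e\<close> of
    \<open>sqrt_bound_resolve\<close>, with \<open>d\<close> the gap and \<open>e\<close> the
    optimal error.\<close>
  have "(E\<^sub>\<xi> - E\<^sub>\<mu>) + 2 * E\<^sub>\<mu> = E\<^sub>\<xi> + E\<^sub>\<mu>" by simp
  then have "sqrt (2 * (E\<^sub>\<xi> + E\<^sub>\<mu>) * S) \<le> S + sqrt (4 * E\<^sub>\<mu> * S + S\<^sup>2)"
    using sqrt_bound_resolve[OF opt E\<^sub>\<mu> S] order_trans[OF gap QE] by metis
  moreover have "S + sqrt (4 * E\<^sub>\<mu> * S + S\<^sup>2) \<le> 2 * S + 2 * sqrt (E\<^sub>\<mu> * S)"
    by (rule sqrt_four_mult_add_square_le[OF E\<^sub>\<mu> S])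
  moreover have "S \<le> absolute_distance ?m ?\<xi> n"
    unfolding S_def by (rule square_distance_le_absolute_distance[OF \<mu> \<xi> ac])
  moreover have "absolute_distance ?m ?\<xi> n \<le> relative_entropy ?m ?\<xi> n"
    by (rule absolute_distance_le_relative_entropy[OF \<mu> \<xi> ac])
  moreover have "relative_entropy ?m ?\<xi> n \<le> ln (inverse (w \<mu>))"
    by (rule relative_entropy_le_ln_inverse[OF \<mu> assms(3)[OF assms(5)] dom])
  ultimately show ?thesis
    using opt gap QE unfolding Let_def E\<^sub>\<xi>_def E\<^sub>\<mu>_def Q_def S_def by blast
qed

end
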